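(* Let $n=(n_x:x\in J_L)$ be an $\ell$-way contingency table with marginalization function $n(\cdot)$, and let $\mathcal{L}$ be the lattice of all subsets of $L=\{1,\dots,\ell\}$. The following functions on $\mathcal{L}$ are increasing and supermodular: (a) for each $s\in\mathcal{L}$, the indicator function $\mathbf{1}_s:\mathcal{L}\to\{0,1\}$ defined by $\mathbf{1}_s(a)=1$ if $s\subset a$ and $\mathbf{1}_s(a)=0$ otherwise; (b) the cumulative function $f(a)=\sum_{s\in\mathcal{L}}\mathbf{1}_s(a)\,n(s)=\sum_{s:\,s\subset a} n(s)$, $a\in\mathcal{L}$ (understood cellwise, i.e., for every $x\in J_L$).
   Context: Let $L=\{1,\dots,\ell\}$ and let $\mathcal{L}$ be the set of all subsets of $L$, partially ordered by inclusion $\subset$ (not necessarily strict), with meet $\cap$ and join $\cup$. A function $h$ on $\mathcal{L}$ is increasing if $h(a)\le h(b)$ whenever $a\subset b$, and supermodular if $h(a\cup b)+h(a\cap b)\ge h(a)+h(b)$ for all $a,b\in\mathcal{L}$. For each $j\in L$ let $I_j$ be a discrete (finite or countable) set of labels, and put $J_L=I_1\times\cdots\times I_\ell$. For $a=\{i_1,\dots,i_p\}\subset L$ put $J_a=I_{i_1}\times\cdots\times I_{i_p}$; each $x\in J_L$ is written $x=(x_a,x_{L\setminus a})$ with $x_a\in J_a$, $x_{L\setminus a}\in J_{L\setminus a}$. An $\ell$-way contingency table is a family $n=(n_x:x\in J_L)$ of non-negative real numbers (typically counts) with finite total sum. The marginalization function assigns to $a\subset L$ the marginal table $n(a)=(n_{x(a),+}: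 x_a\in J_a)$, where $n_{x(a),+}=\sum_{y\in J_{L\setminus a}} n_{(x_a,y)}$. Convention: indices are omitted in a statement that holds for all choices of indices. An expression or inequality involving marginal tables $n(s)$, for various $s$, is to be read for every fixed $x\in J_L$ with each $n(s)$ replaced by the number $n_{x(s),+}$. *)

theory Defs
  imports "HOL-Analysis.Analysis"
begin

definition supermodular_on :: "'i set set \<Rightarrow> ('i set \<Rightarrow> real) \<Rightarrow> bool" where
  "supermodular_on A h \<longleftrightarrow> (\<forall>a\<in>A. \<forall>b\<in>A. h (a \<union> b) + h (a \<inter> b) \<ge> h a + h b)"

definition superset_ind :: "'i set \<Rightarrow> 'i set \<Rightarrow> real" where
  "superset_ind s a = (if s \<subseteq> a then 1 else 0)"

text \<open>
  For a family of label sets I and a set a of coordinates, the product J_a is represented by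
  PiE a I, so a cell of the a-marginal is a function that is undefined outside a, and the
  projection x_a of x is restrict x a.
\<close>

definition contingency_table ::
  "'i set \<Rightarrow> ('i \<Rightarrow> 'v set) \<Rightarrow> (('i \<Rightarrow> 'v) \<Rightarrow> real) \<Rightarrow> bool" where
  "contingency_table L I n \<longleftrightarrow> (\<forall>x\<in>PiE L I. n x \<ge> 0) \<and> n summable_on PiE L I"

text \<open>
  The pair (x_a, y) with y in J_(L - a) is glued to a full cell by merge. The sum is unordered;
  since label sets may be infinite it need not be a finite sum.
\<close>

definition marginal ::
  "'i set \<Rightarrow> ('i \<Rightarrow> 'v set) \<Rightarrow> (('i \<Rightarrow> 'v) \<Rightarrow> real) \<Rightarrow> 'i set \<Rightarrow> ('i \<Rightarrow> 'v) \<Rightarrow> real" where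
  "marginal L I n a xa = (\<Sum>\<^sub>\<infinity>y\<in>PiE (L - a) I. n (merge a (L - a) (xa, y)))"

text \<open>The cumulative function is taken cellwise: x is a fixed full cell, in PiE L I.\<close>

definition cumulative ::
  "'i set \<Rightarrow> ('i \<Rightarrow> 'v set) \<Rightarrow> (('i \<Rightarrow> 'v) \<Rightarrow> real) \<Rightarrow> ('i \<Rightarrow> 'v) \<Rightarrow> 'i set \<Rightarrow> real" where
  "cumulative L I n x a = (\<Sum>s\<in>Pow L. superset_ind s a * marginal L I n s (restrict x s))"

end

theory Submission
  imports Defs
begin

text \<open>Being increasing and being supermodular are linear inequalities in the function, so both
  survive finite combinations with non-negative coefficients. The indicators of the families {a. s
  \<subseteq> a} have both properties. For a fixed cell \<open>x\<close>, \<open>cumulative\<close>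
  is such a combination: the coefficient of \<open>superset_ind s\<close> is the marginal count at
  \<open>restrict x s\<close>, which does not depend on the argument \<open>a\<close> and is
  non-negative by \<open>marginal_nonneg\<close>.\<close>

lemma mono_on_superset_ind: "mono_on A (superset_ind s)"
  by (intro mono_onI) (auto simp: superset_ind_def dest: subsetD)

text \<open>The intersection contains \<open>s\<close> exactly when both sets do, and the union
  contains \<open>s\<close> as soon as one of them does; equality fails only if \<open>s\<close>
  fits in the union but in neither set.\<close>

lemma supermodular_on_superset_ind: "supermodular_on A (superset_ind s)"
  by (auto simp: supermodular_on_def superset_ind_def)

lemma mono_on_nonneg_combination:
  fixes h :: "'s \<Rightarrow> 'i set \<Rightarrow> real"
  assumes "\<And>s. s \<in> S \<Longrightarrow> c s \<ge> 0" "\<And>s. s \<in> S \<Longrightarrow> mono_on A (h s)"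
  shows "mono_on A (\<lambda>a. \<Sum>s\<in>S. h s a * c s)"
  using assms by (intro mono_onI sum_mono mult_right_mono) (auto dest: mono_onD)

lemma supermodular_on_nonneg_combination:
  assumes "\<And>s. s \<in> S \<Longrightarrow> c s \<ge> 0" "\<And>s. s \<in> S \<Longrightarrow> supermodular_on A (h s)"
  shows "supermodular_on A (\<lambda>a. \<Sum>s\<in>S. h s a * c s)"
  \<comment> \<open>Reversed distributivity turns each side into one sum weighted by
    \<open>c s\<close>, so the inequality can be checked term by term.\<close>
  unfolding supermodular_on_def sum.distrib[symmetric] distrib_right[symmetric]
  using assms by (intro ballI sum_mono mult_right_mono) (auto simp: supermodular_on_def)

lemma marginal_nonneg:
  assumes "contingency_table L I n" "s \<subseteq> L" "xs \<in> PiE s I"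
  shows "marginal L I n s xs \<ge> 0"
  unfolding marginal_def
proof (rule infsum_nonneg)
  fix y assume "y \<in> PiE (L - s) I"
  \<comment> \<open>Since \<open>s \<subseteq> L\<close>, the two index sets cover exactly
    \<open>L\<close>; outside it \<open>merge\<close> is \<open>undefined\<close>, as
    \<open>PiE\<close> demands.\<close>
  then have "merge s (L - s) (xs, y) \<in> PiE L I"
    using assms by (auto simp: merge_def PiE_iff extensional_def)
  then show "n (merge s (L - s) (xs, y)) \<ge> 0"
    using assms by (auto simp: contingency_table_def)
qed

text \<open>The indicator kills every term with \<open>s\<close> not inside \<open>a\<close>, and
  all subsets of \<open>a\<close> already lie in \<open>Pow L\<close>.\<close>

lemma cumulative_eq_sum_subsets:
  assumes "finite L" "a \<subseteq> L"
  shows "cumulative L I n x a = (\<Sum>s | s \<subseteq> a. marginal L I n s (restrict x s))"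
  unfolding cumulative_def using assms
  by (intro sum.mono_neutral_cong_right) (auto simp: superset_ind_def)

theorem proposition2p2:
  fixes l :: nat
    and L :: "nat set"
    and I :: "nat \<Rightarrow> 'v set"
    and n :: "(nat \<Rightarrow> 'v) \<Rightarrow> real"
  assumes "L = {1..l}"
    and "\<And>j. j \<in> L \<Longrightarrow> countable (I j)"
    and "contingency_table L I n"
  shows "(\<forall>s\<in>Pow L. mono_on (Pow L) (superset_ind s) \<and> supermodular_on (Pow L) (superset_ind s))
    \<and> (\<forall>x\<in>PiE L I.
          (\<forall>a\<in>Pow L. cumulative L I n x a = (\<Sum>s | s \<subseteq> a. marginal L I n s (restrict x s)))
        \<and> mono_on (Pow L) (cumulative L I n x)
        \<and> supermodular_on (Pow L) (cumulative L I n x))"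
proof (intro conjI ballI)
  fix x assume x: "x \<in> PiE L I"
  have nonneg: "marginal L I n s (restrict x s) \<ge> 0" if "s \<in> Pow L" for s
    using that x assms(3) by (intro marginal_nonneg) auto
  show "mono_on (Pow L) (cumulative L I n x)"
    unfolding cumulative_def
    by (intro mono_on_nonneg_combination nonneg mono_on_superset_ind)
  show "supermodular_on (Pow L) (cumulative L I n x)"
    unfolding cumulative_def
    by (intro supermodular_on_nonneg_combination nonneg supermodular_on_superset_ind)
  show "cumulative L I n x a = (\<Sum>s | s \<subseteq> a. marginal L I n s (restrict x s))"
    if "a \<in> Pow L" for a
    using that assms(1) by (intro cumulative_eq_sum_subsets) auto
qed (rule mono_on_superset_ind supermodular_on_superset_ind)+

end
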